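(* If $G$ is a countable amenable group and $X$ is a strongly irreducible $G$-subshift of finite type, then $X$ is entropy minimal. In particular, if $G$ is a countable amenable group and $X$ is a $G$-subshift with the finite extension property, then $X$ is entropy minimal.
   Context: Let $G$ be a countable group with identity $e$. For a finite nonempty set (alphabet) $\mathcal{A}$ with the discrete topology, $\mathcal{A}^G$ carries the product topology, and $G$ acts by the shift $(\sigma^g x)(h) = x(g^{-1}h)$. A $G$-subshift is a closed set $X \subset \mathcal{A}^G$ with $\sigma^g(X)=X$ for all $g\in G$. Patterns: for $S\subset G$ (possibly infinite or empty), a pattern of shape $S$ is an element $w\in\mathcal{A}^S$; for $S'\subset S$, $w(S')$ denotes the restriction of $w$ to $S'$. For $g\in G$ and $w\in \mathcal{A}^S$, $g\cdot w\in\mathcal{A}^{gS}$ is given by $(g\cdot w)(gs)=w(s)$ for $s \in S$. Let $\mathcal{L}_S(X)=\{x(S):x\in X\}$. If $u\in\mathcal{A}^E$ and $v\in\mathcal{A}^F$ agree on $E\cap F$, then $u\cup v\in\mathcal{A}^{E\cup F}$ denotes their common extension. For finite $K\subset G$ and $\mathcal{F}\subset\mathcal{A}^K$, let $X_{\mathcal{F}}=\{x\in\mathcal{A}^G : \forall g\in G,\ (\sigma^g x)(K)\notin\mathcal{F}\}$. A subshift $X\subset\mathcal{A}^G$ is a subshift of finite type (SFT) if $X=X_{\mathcal{F}}$ for some finite $K\subset G$ and some $\mathcal{F}\subset\mathcal{A}^K$. A subshift $X$ is strongly irreducible if there exists a finite set $K\subset G$ such that for all $E,F\subset G$ and all $u\in\mathcal{L}_E(X)$,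 $v\in\mathcal{L}_F(X)$, if $EK\cap F=\varnothing$ then $u\cup v\in\mathcal{L}_{E\cup F}(X)$. Finite extension property (FEP): a $G$-subshift $X$ with alphabet $\mathcal{A}$ has the FEP if there exist a finite set $K\subset G$ containing $e$ and a collection $\mathcal{F}\subset\mathcal{A}^K$ such that $X=X_{\mathcal{F}}$ and, for every $S\subset G$ and every $w\in\mathcal{A}^S$, if there exists $w'\in\mathcal{A}^{SK}$ with $w'(S)=w$ and $g^{-1}\cdot w'(gK)\notin\mathcal{F}$ for all $g\in S$, then there exists $x\in X$ with $x(S)=w$. Entropy: for $G$ amenable with a Følner sequence $\{F_n\}$, the topological entropy of a nonempty $G$-subshift $X$ is $h(X)=\lim_{n\to\infty}\frac{1}{|F_n|}\log|\mathcal{L}_{F_n}(X)|$ (the limit exists and is independent of the Følner sequence). A subshift $X$ is entropy minimal if every (nonempty) subshift $Y\subsetneq X$ satisfies $h(Y)<h(X)$. *)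

theory Defs
  imports "HOL-Analysis.Analysis" "HOL-Library.Set_Algebras"
begin

text \<open>
  The countable group \<open>G\<close> is a type of class \<open>{group_add, countable}\<close>.  The class \<open>group_add\<close> does
  not assume commutativity: the product \<open>gh\<close> is written \<open>g + h\<close>, the inverse is \<open>- g\<close>, the identity is
  \<open>0\<close>, the left translate \<open>gS\<close> is \<open>(+) g ` S\<close>, and \<open>SK\<close> is the setwise sum \<open>S + K\<close> of
  \<open>HOL-Library.Set_Algebras\<close>.

  The alphabet is a type of class \<open>finite\<close>.  A pattern of shape \<open>S\<close> is an element of the extensional
  function space \<open>S \<rightarrow>\<^sub>E UNIV\<close>, and \<open>w(S')\<close> is \<open>restrict w S'\<close>.
\<close>

definition shift :: "'g::group_add \<Rightarrow> ('g \<Rightarrow> 'a) \<Rightarrow> 'g \<Rightarrow> 'a" where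
  "shift g x = (\<lambda>h. x (- g + h))"

definition subshift :: "('g::group_add \<Rightarrow> 'a::finite) set \<Rightarrow> bool" where
  "subshift X \<longleftrightarrow>
     closedin (product_topology (\<lambda>_. discrete_topology UNIV) UNIV) X \<and> (\<forall>g. shift g ` X = X)"

text \<open>The shape \<open>S\<close> of \<open>w\<close> is an explicit argument, since it cannot be read off the function.\<close>

definition translate_pattern :: "'g::group_add \<Rightarrow> 'g set \<Rightarrow> ('g \<Rightarrow> 'a) \<Rightarrow> 'g \<Rightarrow> 'a" where
  "translate_pattern g S w = (\<lambda>h \<in> (+) g ` S. w (- g + h))"

definition language :: "'g set \<Rightarrow> ('g \<Rightarrow> 'a) set \<Rightarrow> ('g \<Rightarrow> 'a) set" where
  "language S X = (\<lambda>x. restrict x S) ` X"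

definition avoiding :: "'g::group_add set \<Rightarrow> ('g \<Rightarrow> 'a) set \<Rightarrow> ('g \<Rightarrow> 'a) set" where
  "avoiding K \<F> = {x. \<forall>g. restrict (shift g x) K \<notin> \<F>}"

definition finite_type :: "('g::group_add \<Rightarrow> 'a::finite) set \<Rightarrow> bool" where
  "finite_type X \<longleftrightarrow> (\<exists>K \<F>. finite K \<and> \<F> \<subseteq> (K \<rightarrow>\<^sub>E UNIV) \<and> X = avoiding K \<F>)"

text \<open>
  For \<open>u\<close> and \<open>v\<close> of shapes \<open>E\<close> and \<open>F\<close> that agree on \<open>E \<inter> F\<close>, the union \<open>u \<union> v\<close> is
  \<open>override_on v u E\<close>, which is extensional on \<open>E \<union> F\<close>.  The agreement premise says that \<open>u \<union> v\<close> is
  defined; it only matters when \<open>0 \<notin> K\<close>, for otherwise \<open>E\<close> and \<open>F\<close> are disjoint.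
\<close>

definition strongly_irreducible :: "('g::group_add \<Rightarrow> 'a::finite) set \<Rightarrow> bool" where
  "strongly_irreducible X \<longleftrightarrow>
     (\<exists>K. finite K \<and>
       (\<forall>E F. \<forall>u \<in> language E X. \<forall>v \<in> language F X.
          (E + K) \<inter> F = {} \<longrightarrow> (\<forall>g \<in> E \<inter> F. u g = v g) \<longrightarrow>
          override_on v u E \<in> language (E \<union> F) X))"

definition finite_extension_property :: "('g::group_add \<Rightarrow> 'a::finite) set \<Rightarrow> bool" where
  "finite_extension_property X \<longleftrightarrow>
     (\<exists>K \<F>. finite K \<and> 0 \<in> K \<and> \<F> \<subseteq> (K \<rightarrow>\<^sub>E UNIV) \<and> X = avoiding K \<F> \<and>
       (\<forall>S. \<forall>w \<in> S \<rightarrow>\<^sub>E UNIV.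
          (\<exists>w' \<in> (S + K) \<rightarrow>\<^sub>E UNIV. restrict w' S = w \<and>
             (\<forall>g \<in> S. translate_pattern (- g) ((+) g ` K) (restrict w' ((+) g ` K)) \<notin> \<F>)) \<longrightarrow>
          (\<exists>x \<in> X. restrict x S = w)))"

text \<open>
  The shift acts by left translation, so \<open>L\<^bsub>gS\<^esub>(X)\<close> and \<open>L\<^bsub>S\<^esub>(X)\<close> are in bijection, and the entropy
  limit exists and is independent of the sequence for sequences asymptotically invariant under
  \<^emph>\<open>right\<close> translation; this is the side required here.  A group has such a sequence iff it
  has a left-invariant one, by inverting the sets.
\<close>

definition folner_sequence :: "(nat \<Rightarrow> 'g::group_add set) \<Rightarrow> bool" where
  "folner_sequence F \<longleftrightarrow>
     (\<forall>n. finite (F n) \<and> F n \<noteq> {}) \<and>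
     (\<forall>g. (\<lambda>n. real (card (sym_diff ((\<lambda>h. h + g) ` F n) (F n))) / real (card (F n))) \<longlonglongrightarrow> 0)"

definition amenable :: "'g::{group_add, countable} itself \<Rightarrow> bool" where
  "amenable _ \<longleftrightarrow> (\<exists>F :: nat \<Rightarrow> 'g set. folner_sequence F)"

text \<open>The common value of the limits along all Folner sequences; for amenable \<open>G\<close> and \<open>X \<noteq> {}\<close>.\<close>

definition entropy :: "('g::{group_add, countable} \<Rightarrow> 'a::finite) set \<Rightarrow> real" where
  "entropy X =
     (THE h. \<forall>F. folner_sequence F \<longrightarrow>
        (\<lambda>n. ln (real (card (language (F n) X))) / real (card (F n))) \<longlonglongrightarrow> h)"

definition entropy_minimal :: "('g::{group_add, countable} \<Rightarrow> 'a::finite) set \<Rightarrow> bool" where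
  "entropy_minimal X \<longleftrightarrow> (\<forall>Y. subshift Y \<and> Y \<noteq> {} \<and> Y \<subset> X \<longrightarrow> entropy Y < entropy X)"

end

theory Submission
  imports Defs
begin

text \<open>
  Both parts follow from the statement that a strongly irreducible subshift \<open>X\<close> is entropy minimal,
  because the finite extension property implies strong irreducibility: patterns on \<open>E\<close> and \<open>F\<close> extend
  without forbidden windows to \<open>EK\<close> and \<open>FK\<close>, and these extensions do not interact when \<open>EK\<close> and
  \<open>FK\<close> are disjoint (\<open>finite_extension_property_imp_strongly_irreducible\<close>).

  To compare entropies one first needs the limits in their definition, for an arbitrary subshift.
  They come from Shearer's inequality in its counting form, \<open>shearer_inequality\<close>. A Folner set \<open>F\<close> is
  covered \<open>card K\<close> times by about \<open>card F\<close> translates of any finite window \<open>K\<close>, so the number of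
  patterns per site on \<open>F\<close>, measured by the logarithm, is at most that on \<open>K\<close>, up to a boundary term.
  Therefore the limit exists along every Folner sequence and equals the infimum over all finite
  windows (\<open>language_rate_tendsto_entropy\<close>).

  Now let \<open>Y\<close> be a proper subshift of a strongly irreducible \<open>X\<close>. Some finite pattern of \<open>X\<close> does not
  occur in \<open>Y\<close>. Strong irreducibility allows this pattern to be planted into any pattern of \<open>X\<close> by
  changing a bounded number \<open>d\<close> of letters around a chosen site, so among the patterns of \<open>X\<close> the
  fraction without the planted pattern at that site is at most \<open>1 - 1 / C\<close>, where \<open>C\<close> is the number of
  words of length \<open>d\<close>. This can be repeated independently at a positive proportion of the sites of a
  Folner set, so \<open>Y\<close> has exponentially fewer patterns than \<open>X\<close> (\<open>card_avoiding_at_le\<close>,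
  \<open>strongly_irreducible_imp_entropy_less\<close>).
\<close>

section \<open>A counting form of Shearer's inequality\<close>

text \<open>
  Hoelder's inequality for several factors, with roots cleared. After every factor is normalized to
  have sum \<open>1\<close>, the inequality of arithmetic and geometric means bounds each term by the average of
  the normalized factors, and these averages sum to \<open>1\<close>.
\<close>

lemma holder_finite_products:
  fixes x :: "'i \<Rightarrow> 'b \<Rightarrow> real" and y :: "'b \<Rightarrow> real"
  assumes fin: "finite A" "finite J" "J \<noteq> {}"
    and x0: "\<And>j a. x j a \<ge> 0" and y0: "\<And>a. y a \<ge> 0" and C0: "C \<ge> 0"
    and y: "\<And>a. a \<in> A \<Longrightarrow> y a ^ card J \<le> C * (\<Prod>j\<in>J. x j a)"
  shows "(\<Sum>a\<in>A. y a) ^ card J \<le> C * (\<Prod>j\<in>J. \<Sum>a\<in>A. x j a)"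
proof -
  define k where "k = card J"
  have k: "k > 0" using fin by (simp add: k_def card_gt_0_iff)
  define X where "X j = (\<Sum>a\<in>A. x j a)" for j
  have X0: "X j \<ge> 0" for j unfolding X_def by (intro sum_nonneg x0)
  show ?thesis
  proof (cases "\<exists>j\<in>J. X j = 0")
    case True
    then obtain j where j: "j \<in> J" "X j = 0" by blast
    have "y a = 0" if "a \<in> A" for a
    proof -
      have "x j a = 0"
        using j(2) that fin x0 unfolding X_def by (simp add: sum_nonneg_eq_0_iff)
      then have "(\<Prod>j\<in>J. x j a) = 0" using fin j(1) by auto
      then have "y a ^ k \<le> 0" using y[OF that] by (simp add: k_def)
      then show ?thesis
        by (metis k y0 zero_less_power linorder_not_le order_less_le)
    qed
    then have "(\<Sum>a\<in>A. y a) ^ k = 0" using k by (simp add: zero_power)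
    moreover have "0 \<le> C * (\<Prod>j\<in>J. X j)" by (intro mult_nonneg_nonneg C0 prod_nonneg X0 ballI)
    ultimately show ?thesis unfolding k_def X_def by linarith
  next
    case False
    then have Xpos: "X j > 0" if "j \<in> J" for j using X0[of j] that by (force simp: order_less_le)
    \<comment> \<open>\<open>R\<close> is the bound on the sum of the \<open>y a\<close> to be proved; \<open>m a\<close> are weights with sum \<open>1\<close>.\<close>
    define R where "R = root k (C * (\<Prod>j\<in>J. X j))"
    have R0: "R \<ge> 0" unfolding R_def
      by (intro real_root_ge_zero mult_nonneg_nonneg C0 prod_nonneg X0 ballI)
    have Rk: "R ^ k = C * (\<Prod>j\<in>J. X j)" unfolding R_def
      by (intro real_root_pow_pos2 k mult_nonneg_nonneg C0 prod_nonneg X0 ballI)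
    define m where "m a = (\<Sum>j\<in>J. x j a / X j / k)" for a
    have ym: "y a \<le> R * m a" if a: "a \<in> A" for a
    proof -
      define z where "z = (\<Prod>j\<in>J. x j a / X j)"
      have z0: "z \<ge> 0" unfolding z_def using x0 X0 by (intro prod_nonneg) auto
      have m0: "m a \<ge> 0" unfolding m_def using x0 X0 by (intro sum_nonneg) auto
      have "z powr (1 / k) \<le> m a"
        using arith_geom_mean[of J "\<lambda>j. x j a / X j"] fin x0 X0
        by (simp add: z_def m_def k_def)
      then have "(z powr (1 / k)) ^ k \<le> m a ^ k" by (intro power_mono) auto
      moreover have "(z powr (1 / k)) ^ k = z"
        using k z0 by (cases "z = 0") (simp_all add: powr_powr flip: powr_realpow)
      ultimately have zm: "z \<le> m a ^ k" by simp
      have "(\<Prod>j\<in>J. X j) \<noteq> 0" using Xpos fin by (auto simp: less_le)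
      then have "y a ^ k \<le> R ^ k * z"
        using y[OF a] unfolding Rk z_def prod_dividef by (simp add: k_def)
      also have "\<dots> \<le> R ^ k * m a ^ k" using zm R0 by (intro mult_left_mono) auto
      finally have "y a ^ k \<le> (R * m a) ^ k" by (simp add: power_mult_distrib)
      then show ?thesis using y0 R0 m0 k by (simp add: power_mono_iff)
    qed
    have "(\<Sum>a\<in>A. m a) = (\<Sum>j\<in>J. \<Sum>a\<in>A. x j a / X j / k)"
      unfolding m_def by (rule sum.swap)
    also have "\<dots> = (\<Sum>j\<in>J. 1 / k)"
    proof (rule sum.cong)
      fix j assume "j \<in> J"
      then have "X j \<noteq> 0" using False by blast
      then show "(\<Sum>a\<in>A. x j a / X j / k) = 1 / k"
        by (simp add: X_def flip: sum_divide_distrib)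
    qed simp
    also have "\<dots> = 1" using k by (simp add: k_def)
    finally have "(\<Sum>a\<in>A. m a) = 1" .
    then have "(\<Sum>a\<in>A. y a) \<le> R"
      using sum_mono[of A y "\<lambda>a. R * m a"] ym by (simp flip: sum_distrib_left)
    then have "(\<Sum>a\<in>A. y a) ^ k \<le> R ^ k" by (intro power_mono sum_nonneg y0)
    then show ?thesis unfolding Rk by (simp add: k_def X_def)
  qed
qed

lemma language_subset_PiE: "language S X \<subseteq> S \<rightarrow>\<^sub>E UNIV"
  by (auto simp: language_def)

lemma finite_language:
  fixes X :: "('g \<Rightarrow> 'a::finite) set"
  shows "finite S \<Longrightarrow> finite (language S X)"
  by (rule finite_subset[OF language_subset_PiE]) (simp add: finite_PiE)

lemma card_language_le:
  fixes X :: "('g \<Rightarrow> 'a::finite) set"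
  assumes "finite S"
  shows "card (language S X) \<le> CARD('a) ^ card S"
  using card_mono[OF _ language_subset_PiE, of S X] assms
  by (simp add: finite_PiE card_PiE)

lemma language_mono: "X \<subseteq> Y \<Longrightarrow> language S X \<subseteq> language S Y"
  unfolding language_def by (rule image_mono)

lemma card_language_mono:
  fixes Y :: "('g \<Rightarrow> 'a::finite) set"
  shows "finite S \<Longrightarrow> X \<subseteq> Y \<Longrightarrow> card (language S X) \<le> card (language S Y)"
  by (intro card_mono finite_language language_mono)

lemma card_language_pos:
  fixes X :: "('g \<Rightarrow> 'a::finite) set"
  shows "finite S \<Longrightarrow> X \<noteq> {} \<Longrightarrow> card (language S X) > 0"
  using finite_language[of S X] by (simp add: card_gt_0_iff) (simp add: language_def)

lemma card_language_eq_sum_slices: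
  fixes X :: "('g \<Rightarrow> 'a::finite) set"
  assumes "finite S" "f \<in> S"
  shows "card (language S X) = (\<Sum>a\<in>UNIV. card (language S {x \<in> X. x f = a}))"
proof -
  have "language S X = (\<Union>a. language S {x \<in> X. x f = a})"
    by (auto simp: language_def)
  moreover have "language S {x \<in> X. x f = a} \<inter> language S {x \<in> X. x f = b} = {}"
    if "a \<noteq> b" for a b
  proof -
    have "w f = a" if "w \<in> language S {x \<in> X. x f = a}" for w a
      using that assms(2) by (auto simp: language_def)
    then show ?thesis using that by blast
  qed
  ultimately show ?thesis
    by (simp add: card_UN_disjoint finite_language assms)
qed

text \<open>A coordinate whose value is prescribed carries no information.\<close>

lemma card_language_insert_slice_le:
  fixes X :: "('g \<Rightarrow> 'a::finite) set"
  assumes "finite F" "\<And>x. x \<in> X \<Longrightarrow> x f = a"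
  shows "card (language (insert f F) X) \<le> card (language F X)"
proof (rule surj_card_le)
  show "finite (language F X)" by (intro finite_language assms)
  show "language (insert f F) X \<subseteq> (\<lambda>w. w(f := a)) ` language F X"
  proof
    fix w assume "w \<in> language (insert f F) X"
    then obtain x where x: "x \<in> X" "w = restrict x (insert f F)" by (auto simp: language_def)
    then have "w = (restrict x F)(f := a)" using assms(2) by auto
    then show "w \<in> (\<lambda>w. w(f := a)) ` language F X" using x by (auto simp: language_def)
  qed
qed

text \<open>
  If the windows \<open>S i\<close> cover every site of \<open>F\<close> at least \<open>k\<close> times, then the patterns on the windows
  control those on \<open>F\<close>. Induction on \<open>F\<close>: a new site \<open>f\<close> splits \<open>X\<close> into slices \<open>Z a\<close> according
  to the letter at \<open>f\<close>. The induction hypothesis applies to each slice. On \<open>k\<close> chosen windows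
  that contain \<open>f\<close> the slices have disjoint sets of patterns, so Hoelder's inequality
  reassembles them; on the other windows a slice has at most as many patterns as \<open>X\<close>.
\<close>

theorem shearer_inequality:
  fixes X :: "('g \<Rightarrow> 'a::finite) set" and S :: "'i \<Rightarrow> 'g set"
  assumes "finite F" and I: "finite I" and S: "\<And>i. i \<in> I \<Longrightarrow> finite (S i)" and k: "k > 0"
    and "\<And>f. f \<in> F \<Longrightarrow> k \<le> card {i \<in> I. f \<in> S i}"
  shows "card (language F X) ^ k \<le> (\<Prod>i\<in>I. card (language (S i) X))"
  using assms(1,5)
proof (induction F arbitrary: X rule: finite_induct)
  case empty
  show ?case
  proof (cases "X = {}")
    case True
    then show ?thesis using k by (simp add: language_def zero_power)
  next
    case False
    then have "(\<Prod>i\<in>I. card (language (S i) X)) \<ge> 1"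
      using S by (intro prod_ge_1) (simp add: Suc_le_eq card_language_pos)
    moreover have "card (language {} X) ^ k \<le> 1"
      using power_mono[OF card_language_le[of "{}" X]] by simp
    ultimately show ?thesis by linarith
  qed
next
  case (insert f F)
  define Z where "Z a = {x \<in> X. x f = a}" for a
  obtain J where J: "J \<subseteq> {i \<in> I. f \<in> S i}" "card J = k"
    using obtain_subset_with_card_n insert.prems[of f] by blast
  have JI: "J \<subseteq> I" and Jne: "J \<noteq> {}" using J k by auto
  have finJ: "finite J" using JI I by (rule finite_subset)
  define C where "C = (\<Prod>i\<in>I - J. card (language (S i) X))"
  have split: "(\<Prod>i\<in>I. g i) = (\<Prod>i\<in>I - J. g i) * (\<Prod>i\<in>J. g i)" for g :: "'i \<Rightarrow> nat"
    by (rule prod.subset_diff[OF JI I])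
  have slice: "real (card (language F (Z a))) ^ card J
      \<le> real C * (\<Prod>j\<in>J. real (card (language (S j) (Z a))))" for a
  proof -
    have "card (language F (Z a)) ^ k \<le> (\<Prod>i\<in>I. card (language (S i) (Z a)))"
      using insert.prems by (intro insert.IH) auto
    also have "\<dots> \<le> C * (\<Prod>i\<in>J. card (language (S i) (Z a)))"
      unfolding split C_def
      by (intro mult_right_mono prod_mono) (auto simp: Z_def S intro!: card_language_mono)
    finally show ?thesis unfolding J(2)
      by (simp only: flip: of_nat_power of_nat_prod of_nat_mult of_nat_le_iff)
  qed
  have "card (language (insert f F) X) = (\<Sum>a\<in>UNIV. card (language (insert f F) (Z a)))"
    unfolding Z_def by (rule card_language_eq_sum_slices) (use insert.hyps in auto)
  also have "\<dots> \<le> (\<Sum>a\<in>UNIV. card (language F (Z a)))"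
    using insert.hyps by (intro sum_mono card_language_insert_slice_le) (auto simp: Z_def)
  finally have "real (card (language (insert f F) X)) ^ k
      \<le> (\<Sum>a\<in>UNIV. real (card (language F (Z a)))) ^ card J"
    unfolding J(2) by (intro power_mono) (simp_all flip: of_nat_sum)
  also have "\<dots> \<le> real C * (\<Prod>j\<in>J. \<Sum>a\<in>UNIV. real (card (language (S j) (Z a))))"
    using slice by (intro holder_finite_products finJ Jne) auto
  also have "(\<Prod>j\<in>J. \<Sum>a\<in>UNIV. real (card (language (S j) (Z a))))
      = (\<Prod>j\<in>J. real (card (language (S j) X)))"
  proof (rule prod.cong)
    fix j assume "j \<in> J"
    then have "f \<in> S j" "finite (S j)" using J S by auto
    then show "(\<Sum>a\<in>UNIV. real (card (language (S j) (Z a)))) = real (card (language (S j) X))"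
      unfolding Z_def by (simp add: card_language_eq_sum_slices[of "S j" f X])
  qed simp
  finally show ?case
    unfolding split C_def
    by (simp only: flip: of_nat_power of_nat_prod of_nat_mult of_nat_le_iff)
qed

section \<open>Entropy as an infimum over finite windows\<close>

definition shift_invariant :: "('g::group_add \<Rightarrow> 'a) set \<Rightarrow> bool" where
  "shift_invariant X \<longleftrightarrow> (\<forall>g. \<forall>x\<in>X. shift g x \<in> X)"

lemma subshift_imp_shift_invariant: "subshift X \<Longrightarrow> shift_invariant X"
  unfolding subshift_def shift_invariant_def by blast

lemma shift_uminus_apply: "shift (- g) x h = x (g + h)"
  by (simp add: shift_def)

lemma card_language_translate_le:
  fixes X :: "('g::group_add \<Rightarrow> 'a::finite) set"
  assumes "shift_invariant X" "finite S"
  shows "card (language ((+) g ` S) X) \<le> card (language S X)"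
proof (rule surj_card_le)
  show "finite (language S X)" by (intro finite_language assms)
  show "language ((+) g ` S) X \<subseteq> translate_pattern g S ` language S X"
  proof
    fix w assume "w \<in> language ((+) g ` S) X"
    then obtain x where x: "x \<in> X" "w = restrict x ((+) g ` S)" by (auto simp: language_def)
    have "w = translate_pattern g S (restrict (shift (- g) x) S)"
      unfolding x(2) translate_pattern_def
      by (rule restrict_ext) (auto simp: shift_uminus_apply simp flip: add.assoc)
    moreover have "shift (- g) x \<in> X" using assms x by (auto simp: shift_invariant_def)
    ultimately show "w \<in> translate_pattern g S ` language S X" by (auto simp: language_def)
  qed
qed

definition right_boundary :: "'g::group_add set \<Rightarrow> 'g set \<Rightarrow> 'g set" where
  "right_boundary D F = {f \<in> F. \<exists>d\<in>D. f + d \<notin> F}"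

lemma card_right_boundary_le:
  fixes F :: "'g::group_add set"
  assumes "finite F" "finite D"
  shows "card (right_boundary D F) \<le> (\<Sum>d\<in>D. card (sym_diff ((\<lambda>h. h + d) ` F) F))"
proof -
  have "card {f \<in> F. f + d \<notin> F} \<le> card (sym_diff ((\<lambda>h. h + d) ` F) F)" for d
    by (rule card_inj_on_le[where f = "\<lambda>h. h + d"]) (use assms in \<open>auto simp: inj_on_def\<close>)
  moreover have "right_boundary D F = (\<Union>d\<in>D. {f \<in> F. f + d \<notin> F})"
    by (auto simp: right_boundary_def)
  ultimately show ?thesis
    using card_UN_le[OF assms(2), of "\<lambda>d. {f \<in> F. f + d \<notin> F}"]
    by (metis (no_types, lifting) order_trans sum_mono)
qed

text \<open>
  A site of \<open>F\<close> that the translation by \<open>d\<close> moves out of \<open>F\<close> gives an element of the symmetric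
  difference in the Folner condition, and only finitely many \<open>d\<close> are involved.
\<close>

lemma folner_right_boundary_tendsto_0:
  assumes "folner_sequence F" "finite D"
  shows "(\<lambda>n. real (card (right_boundary D (F n))) / real (card (F n))) \<longlonglongrightarrow> 0"
proof (rule tendsto_sandwich)
  have fin: "finite (F n)" for n using assms by (auto simp: folner_sequence_def)
  show "\<forall>\<^sub>F n in sequentially. 0 \<le> real (card (right_boundary D (F n))) / real (card (F n))"
    by simp
  show "\<forall>\<^sub>F n in sequentially. real (card (right_boundary D (F n))) / real (card (F n))
      \<le> (\<Sum>d\<in>D. real (card (sym_diff ((\<lambda>h. h + d) ` F n) (F n))) / real (card (F n)))"
    unfolding sum_divide_distrib[symmetric] of_nat_sum[symmetric]
    by (intro always_eventually allI divide_right_mono of_nat_mono card_right_boundary_le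
        fin assms) simp
  show "(\<lambda>n. \<Sum>d\<in>D. real (card (sym_diff ((\<lambda>h. h + d) ` F n) (F n))) / real (card (F n)))
      \<longlonglongrightarrow> 0"
    using assms unfolding folner_sequence_def by (intro tendsto_null_sum) auto
qed simp

text \<open>
  Shearer's inequality for the traces \<open>gK \<inter> F\<close> of the translates of \<open>K\<close>: a site \<open>f\<close> lies in \<open>gK\<close>
  exactly for the \<open>card K\<close> elements \<open>g = f - k\<close>. At most \<open>card F\<close> translates lie inside \<open>F\<close>, and
  each of them sees at most as many patterns as \<open>K\<close>. A translate \<open>gK\<close> that meets \<open>F\<close> in
  \<open>g + k\<close> but leaves it at \<open>g + k'\<close> puts \<open>g + k\<close> into the boundary of \<open>F\<close> for the difference
  \<open>- k + k'\<close>; for these the trivial bound suffices.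
\<close>

lemma card_language_power_le:
  fixes X :: "('g::group_add \<Rightarrow> 'a::finite) set"
  assumes X: "shift_invariant X" "X \<noteq> {}" and F: "finite F" and K: "finite K" "K \<noteq> {}"
  defines "D \<equiv> (\<lambda>(k, k'). - k + k') ` (K \<times> K)"
  shows "card (language F X) ^ card K
    \<le> card (language K X) ^ card F * (CARD('a) ^ card K) ^ (card K * card (right_boundary D F))"
proof -
  \<comment> \<open>\<open>I\<close> indexes the translates meeting \<open>F\<close>, \<open>I1\<close> those inside \<open>F\<close> and \<open>I2\<close> those crossing its boundary.\<close>
  define I where "I = (\<Union>k\<in>K. (\<lambda>f. f - k) ` F)"
  define I1 where "I1 = {g \<in> I. (+) g ` K \<subseteq> F}"
  define I2 where "I2 = I - I1"
  let ?S = "\<lambda>g. (+) g ` K \<inter> F"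
  have finI: "finite I" unfolding I_def using F K by auto
  have mult: "card K \<le> card {g \<in> I. f \<in> ?S g}" if f: "f \<in> F" for f
  proof (rule card_inj_on_le)
    show "inj_on (\<lambda>k. f - k) K"
      by (auto simp: inj_on_def diff_conv_add_uminus simp del: add_uminus_conv_diff)
    have "f \<in> (+) (f - k) ` K" if "k \<in> K" for k using that by (intro image_eqI[of _ _ k]) auto
    then show "(\<lambda>k. f - k) ` K \<subseteq> {g \<in> I. f \<in> ?S g}" using f by (auto simp: I_def)
    show "finite {g \<in> I. f \<in> ?S g}" using finI by simp
  qed
  have cI1: "card I1 \<le> card F"
  proof -
    obtain k where k: "k \<in> K" using K by auto
    show ?thesis
      by (rule card_inj_on_le[where f = "\<lambda>g. g + k"])
        (use F k in \<open>auto simp: I1_def inj_on_def\<close>)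
  qed
  have cI2: "card I2 \<le> card K * card (right_boundary D F)"
  proof -
    have "I2 \<subseteq> (\<Union>k\<in>K. (\<lambda>f. f - k) ` right_boundary D F)"
    proof
      fix g assume "g \<in> I2"
      then obtain k f k' where *: "k \<in> K" "f \<in> F" "g = f - k" "k' \<in> K" "g + k' \<notin> F"
        by (auto simp: I2_def I1_def I_def)
      then have "f + (- k + k') \<notin> F" by (simp add: diff_conv_add_uminus add.assoc del: add_uminus_conv_diff)
      then have "f \<in> right_boundary D F"
        using * by (auto simp: right_boundary_def D_def intro!: bexI[of _ "(k, k')"])
      then show "g \<in> (\<Union>k\<in>K. (\<lambda>f. f - k) ` right_boundary D F)" using * by blast
    qed
    then have "card I2 \<le> card (\<Union>k\<in>K. (\<lambda>f. f - k) ` right_boundary D F)"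
      using F K by (intro card_mono) (auto simp: right_boundary_def)
    also have "\<dots> \<le> (\<Sum>k\<in>K. card ((\<lambda>f. f - k) ` right_boundary D F))"
      by (rule card_UN_le[OF K(1)])
    also have "\<dots> \<le> (\<Sum>k\<in>K. card (right_boundary D F))"
      using F by (intro sum_mono card_image_le) (auto simp: right_boundary_def)
    finally show ?thesis by simp
  qed
  have "card (language F X) ^ card K \<le> (\<Prod>g\<in>I. card (language (?S g) X))"
    by (rule shearer_inequality[OF F finI]) (use F K mult in \<open>auto simp: card_gt_0_iff\<close>)
  also have "\<dots> = (\<Prod>g\<in>I1. card (language (?S g) X)) * (\<Prod>g\<in>I2. card (language (?S g) X))"
    unfolding I2_def using prod.subset_diff[of I1 I] finI by (auto simp: I1_def mult.commute)
  also have "\<dots> \<le> (\<Prod>g\<in>I1. card (language K X)) * (\<Prod>g\<in>I2. CARD('a) ^ card K)"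
  proof (intro mult_mono prod_mono conjI)
    fix g assume "g \<in> I1"
    then have "?S g = (+) g ` K" by (auto simp: I1_def)
    then show "card (language (?S g) X) \<le> card (language K X)"
      using card_language_translate_le[OF X(1) K(1)] by simp
  next
    fix g assume "g \<in> I2"
    have "card (?S g) \<le> card K"
      using K by (intro order_trans[OF card_mono card_image_le]) auto
    then show "card (language (?S g) X) \<le> CARD('a) ^ card K"
      using F by (intro order_trans[OF card_language_le] power_increasing) (auto simp: Suc_le_eq)
  qed (auto intro: prod_nonneg)
  also have "\<dots> \<le> card (language K X) ^ card F
      * (CARD('a) ^ card K) ^ (card K * card (right_boundary D F))"
    using cI1 cI2 card_language_pos[OF K(1) X(2)]
    by (simp only: prod_constant) (intro mult_mono power_increasing; simp add: Suc_le_eq)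
  finally show ?thesis .
qed

definition language_rate :: "('g \<Rightarrow> 'a) set \<Rightarrow> 'g set \<Rightarrow> real" where
  "language_rate X F = ln (real (card (language F X))) / real (card F)"

lemma language_rate_le:
  fixes X :: "('g::group_add \<Rightarrow> 'a::finite) set"
  assumes X: "shift_invariant X" "X \<noteq> {}" and F: "finite F" "F \<noteq> {}" and K: "finite K" "K \<noteq> {}"
  defines "D \<equiv> (\<lambda>(k, k'). - k + k') ` (K \<times> K)"
  shows "language_rate X F \<le> language_rate X K
    + card K * ln (CARD('a)) * (real (card (right_boundary D F)) / real (card F))"
proof -
  let ?b = "card (right_boundary D F)"
  have pos: "card (language F X) > 0" "card (language K X) > 0"
    using F K X by (intro card_language_pos; simp)+
  have cpos: "real (card F) > 0" "real (card K) > 0" using F K by (auto simp: card_gt_0_iff)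
  have "real (card (language F X) ^ card K)
      \<le> real (card (language K X) ^ card F * (CARD('a) ^ card K) ^ (card K * ?b))"
    unfolding D_def by (intro of_nat_mono card_language_power_le X F K)
  then have "ln (real (card (language F X) ^ card K))
      \<le> ln (real (card (language K X) ^ card F * (CARD('a) ^ card K) ^ (card K * ?b)))"
    using pos by (subst ln_le_cancel_iff) auto
  then have "card K * ln (card (language F X))
      \<le> card F * ln (card (language K X)) + card K * ?b * (card K * ln (CARD('a)))"
    using pos by (simp add: ln_mult ln_realpow)
  then have "ln (card (language F X)) / card F \<le> ln (card (language K X)) / card K
      + card K * ?b * ln (CARD('a)) / card F"
    using cpos by (simp add: field_simps)
  then show ?thesis by (simp add: language_rate_def mult_ac)
qed

text \<open>
  The infimum is a lower bound because each \<open>F n\<close> is itself one of the windows. It is also approached: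
  a window \<open>K\<close> that almost attains it bounds the rate on \<open>F n\<close> up to a boundary term that vanishes.
\<close>

lemma language_rate_tendsto_Inf:
  fixes X :: "('g::group_add \<Rightarrow> 'a::finite) set"
  assumes X: "shift_invariant X" "X \<noteq> {}" and F: "folner_sequence F"
  shows "(\<lambda>n. language_rate X (F n)) \<longlonglongrightarrow> (INF K\<in>{K. finite K \<and> K \<noteq> {}}. language_rate X K)"
    (is "_ \<longlonglongrightarrow> Inf (_ ` ?W)")
proof (rule decreasing_tendsto)
  have Fn: "F n \<in> ?W" for n using F by (auto simp: folner_sequence_def)
  have "language_rate X K \<ge> 0" if "K \<in> ?W" for K
    using that card_language_pos[of K X] X
    unfolding language_rate_def by (intro divide_nonneg_nonneg ln_ge_zero) (auto simp: Suc_le_eq)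
  then have bdd: "bdd_below (language_rate X ` ?W)" by (intro bdd_belowI[of _ 0]) blast
  show "\<forall>\<^sub>F n in sequentially. (INF K\<in>?W. language_rate X K) \<le> language_rate X (F n)"
    by (intro always_eventually allI cINF_lower bdd Fn)
  fix r assume "(INF K\<in>?W. language_rate X K) < r"
  then obtain K where K: "K \<in> ?W" "language_rate X K < r"
    using Fn by (subst (asm) cInf_less_iff[OF _ bdd]) auto
  define D where "D = (\<lambda>(k, k'). - k + k') ` (K \<times> K)"
  have "(\<lambda>n. language_rate X K
      + card K * ln (CARD('a)) * (real (card (right_boundary D (F n))) / real (card (F n))))
      \<longlonglongrightarrow> language_rate X K + card K * ln (CARD('a)) * 0"
    using K by (intro tendsto_intros folner_right_boundary_tendsto_0 F) (auto simp: D_def)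
  then have "\<forall>\<^sub>F n in sequentially. language_rate X K
      + card K * ln (CARD('a)) * (real (card (right_boundary D (F n))) / real (card (F n))) < r"
    using K(2) by (intro order_tendstoD(2)) auto
  then show "\<forall>\<^sub>F n in sequentially. language_rate X (F n) < r"
  proof eventually_elim
    case (elim n)
    then show ?case
      using language_rate_le[OF X, of "F n" K] Fn[of n] K by (auto simp: D_def)
  qed
qed

text \<open>
  The infimum does not depend on the Folner sequence, so it is the common limit that defines the
  entropy. A Folner sequence must exist for this limit to be unique.
\<close>

theorem language_rate_tendsto_entropy:
  fixes X :: "('g::{group_add, countable} \<Rightarrow> 'a::finite) set"
  assumes X: "shift_invariant X" "X \<noteq> {}" and F: "folner_sequence F"
  shows "(\<lambda>n. language_rate X (F n)) \<longlonglongrightarrow> entropy X"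
proof -
  let ?h = "INF K\<in>{K. finite K \<and> K \<noteq> {}}. language_rate X K"
  have "entropy X = ?h"
    unfolding entropy_def language_rate_def[symmetric]
  proof (rule the_equality)
    show "\<forall>F. folner_sequence F \<longrightarrow> (\<lambda>n. language_rate X (F n)) \<longlonglongrightarrow> ?h"
      using language_rate_tendsto_Inf[OF X] by blast
    fix h assume "\<forall>F. folner_sequence F \<longrightarrow> (\<lambda>n. language_rate X (F n)) \<longlonglongrightarrow> h"
    then show "h = ?h"
      using F language_rate_tendsto_Inf[OF X F] LIMSEQ_unique by blast
  qed
  then show ?thesis using language_rate_tendsto_Inf[OF X F] by simp
qed

section \<open>Omitting a pattern costs entropy\<close>

text \<open>A basic open neighbourhood of \<open>x\<close> that misses \<open>Y\<close> constrains only finitely many coordinates.\<close>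

lemma closed_set_omits_finite_pattern:
  assumes "closedin (product_topology (\<lambda>_. discrete_topology UNIV) UNIV) Y" "x \<notin> Y"
  shows "\<exists>S. finite S \<and> restrict x S \<notin> language S Y"
proof -
  have "openin (product_topology (\<lambda>_. discrete_topology UNIV) UNIV) (- Y)"
    using assms(1) by (simp add: closedin_def Compl_eq_Diff_UNIV)
  with assms(2) obtain U where U: "finite {i. U i \<noteq> UNIV}" "x \<in> Pi\<^sub>E UNIV U" "Pi\<^sub>E UNIV U \<subseteq> - Y"
    unfolding openin_product_topology_alt by (simp add: PiE_UNIV_domain) blast
  define S where "S = {i. U i \<noteq> UNIV}"
  have "restrict x S \<notin> language S Y"
  proof
    assume "restrict x S \<in> language S Y"
    then obtain y where y: "y \<in> Y" "restrict x S = restrict y S" by (auto simp: language_def)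
    have "y i \<in> U i" for i
    proof (cases "i \<in> S")
      case True
      then have "y i = x i" using y(2) by (metis restrict_apply')
      then show ?thesis using U(2) by auto
    qed (simp add: S_def)
    then show False using U(3) y(1) by auto
  qed
  then show ?thesis using U(1) S_def by blast
qed

text \<open>
  For a maximal disjoint family \<open>M\<close>, every \<open>h \<in> A\<close> has \<open>hD\<close> meeting some \<open>gD\<close> with \<open>g \<in> M\<close>, so
  \<open>h\<close> is one of the elements \<open>g + d - d'\<close>.
\<close>

lemma exists_many_disjoint_translates:
  fixes A :: "'g::group_add set"
  assumes "finite A" "finite D" "D \<noteq> {}"
  obtains M where "M \<subseteq> A" "pairwise (\<lambda>g h. disjnt ((+) g ` D) ((+) h ` D)) M"
    "card A \<le> card M * (card D)\<^sup>2"
proof -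
  let ?P = "{M. M \<subseteq> A \<and> pairwise (\<lambda>g h. disjnt ((+) g ` D) ((+) h ` D)) M}"
  have "finite ?P" using assms by (auto intro: finite_subset[of _ "Pow A"])
  moreover have "{} \<in> ?P" by simp
  ultimately have "\<exists>M\<in>?P. \<forall>N\<in>?P. M \<subseteq> N \<longrightarrow> M = N"
    by (intro finite_has_maximal) auto
  then obtain M where M: "M \<in> ?P" and max: "\<forall>N\<in>?P. M \<subseteq> N \<longrightarrow> M = N" by (rule bexE)
  have "A \<subseteq> (\<lambda>(g, d, d'). g + d - d') ` (M \<times> D \<times> D)"
  proof
    fix h assume h: "h \<in> A"
    have "\<exists>g\<in>M. \<exists>d\<in>D. \<exists>d'\<in>D. g + d = h + d'"
    proof (cases "h \<in> M")
      case True
      then show ?thesis using assms(3) by blast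
    next
      case False
      then have "insert h M \<notin> ?P" using max by blast
      then obtain g where "g \<in> M" "\<not> disjnt ((+) g ` D) ((+) h ` D)"
        using M h by (simp add: pairwise_insert) (metis disjnt_sym)
      moreover from this(2) obtain d d' where "d \<in> D" "d' \<in> D" "g + d = h + d'"
        by (auto simp: disjnt_iff)
      ultimately show ?thesis by blast
    qed
    then obtain g d d' where *: "g \<in> M" "d \<in> D" "d' \<in> D" "g + d = h + d'" by blast
    then have "h = g + d - d'" by simp
    with * show "h \<in> (\<lambda>(g, d, d'). g + d - d') ` (M \<times> D \<times> D)"
      by (intro image_eqI[of _ _ "(g, d, d')"]) auto
  qed
  moreover have "finite (M \<times> D \<times> D)" using M assms finite_subset[of M A] by simp
  ultimately have "card A \<le> card (M \<times> D \<times> D)" by (intro surj_card_le)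
  then show thesis using that[of M] M by (simp add: card_cartesian_product power2_eq_square)
qed

text \<open>The condition on the set \<open>K\<close> in the definition of strong irreducibility.\<close>

definition gluing_across :: "'g::group_add set \<Rightarrow> ('g \<Rightarrow> 'a) set \<Rightarrow> bool" where
  "gluing_across K X \<longleftrightarrow>
     (\<forall>E F. \<forall>u \<in> language E X. \<forall>v \<in> language F X.
        (E + K) \<inter> F = {} \<longrightarrow> (\<forall>g \<in> E \<inter> F. u g = v g) \<longrightarrow>
        override_on v u E \<in> language (E \<union> F) X)"

text \<open>The same property in terms of points instead of patterns, for disjoint shapes.\<close>

lemma gluing_across_obtain:
  fixes K :: "'g::group_add set"
  assumes "gluing_across K X"
    and "x \<in> X" "y \<in> X" "(E + K) \<inter> T = {}" "E \<inter> T = {}"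
  obtains z where "z \<in> X" "\<And>h. h \<in> E \<Longrightarrow> z h = x h" "\<And>h. h \<in> T \<Longrightarrow> z h = y h"
proof -
  have "override_on (restrict y T) (restrict x E) E \<in> language (E \<union> T) X"
    using assms unfolding gluing_across_def by (auto simp: language_def)
  then obtain z where z: "z \<in> X" "override_on (restrict y T) (restrict x E) E = restrict z (E \<union> T)"
    by (auto simp: language_def)
  have "z h = override_on (restrict y T) (restrict x E) E h" if "h \<in> E \<union> T" for h
    using that z(2) by simp
  moreover have "override_on (restrict y T) (restrict x E) E h = y h" if "h \<in> T" for h
    using that assms(5) by (auto simp: override_on_def)
  ultimately show thesis using that[OF z(1)] by (simp add: override_on_def)
qed

text \<open>The configurations without an occurrence of the pattern \<open>p(S)\<close> at any site of \<open>M\<close>.\<close>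

definition avoiding_at :: "'g::group_add set \<Rightarrow> ('g \<Rightarrow> 'a) \<Rightarrow> 'g set \<Rightarrow> ('g \<Rightarrow> 'a) set" where
  "avoiding_at S p M = {w. \<forall>g\<in>M. \<exists>s\<in>S. w (g + s) \<noteq> p s}"

text \<open>
  A pattern \<open>w\<close> that avoids \<open>p(S)\<close> at the sites of \<open>M\<close> can be changed inside \<open>gD\<close> alone so that
  \<open>p(S)\<close> occurs at \<open>g\<close>: the set \<open>D\<close> contains \<open>S\<close> and all \<open>s - k\<close>, so \<open>F - gD\<close> and \<open>gS\<close> can be
  glued. Since \<open>gD\<close> is disjoint from the sets \<open>hD\<close> with \<open>h \<in> M\<close>, the new pattern still avoids
  \<open>p(S)\<close> on \<open>M\<close>. At most \<open>C\<close> patterns \<open>w\<close> lead to the same result, as they differ only on \<open>gD\<close>;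
  hence at least the fraction \<open>1 / C\<close> of the patterns avoiding \<open>p(S)\<close> on \<open>M\<close> does not avoid it at \<open>g\<close>.
\<close>

lemma card_avoiding_one_more_site:
  fixes X :: "('g::group_add \<Rightarrow> 'a::finite) set"
  assumes K: "gluing_across K X"
    and X: "shift_invariant X" and p: "p \<in> X" and F: "finite F" and D: "finite D"
    and SD: "S \<subseteq> D" and SKD: "\<And>s k. s \<in> S \<Longrightarrow> k \<in> K \<Longrightarrow> s - k \<in> D"
    and gF: "(+) g ` D \<subseteq> F" and MF: "\<And>h. h \<in> M \<Longrightarrow> (+) h ` D \<subseteq> F"
    and disj: "\<And>h. h \<in> M \<Longrightarrow> disjnt ((+) g ` D) ((+) h ` D)"
  defines "C \<equiv> real (CARD('a) ^ card D)"
  shows "real (card (language F X \<inter> avoiding_at S p (insert g M)))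
    \<le> (1 - 1 / C) * real (card (language F X \<inter> avoiding_at S p M))"
proof -
  let ?Z = "language F X \<inter> avoiding_at S p M"
  let ?Z' = "language F X \<inter> avoiding_at S p (insert g M)"
  let ?gD = "(+) g ` D"
  have fin: "finite ?Z" using F by (simp add: finite_language)
  have sub: "?Z' \<subseteq> ?Z" by (auto simp: avoiding_at_def)
  have C0: "C > 0" unfolding C_def by simp
  \<comment> \<open>\<open>w\<close> is recovered from the changed pattern \<open>z\<close> and the original letters \<open>u\<close> on \<open>gD\<close>.\<close>
  have "?Z \<subseteq> (\<lambda>(z, u). override_on z u ?gD) ` ((?Z - ?Z') \<times> (?gD \<rightarrow>\<^sub>E UNIV))"
  proof
    fix w assume w: "w \<in> ?Z"
    then obtain x where x: "x \<in> X" "w = restrict x F" by (auto simp: language_def)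
    have "shift g p \<in> X" using X p by (auto simp: shift_invariant_def)
    moreover have "((F - ?gD) + K) \<inter> ((+) g ` S) = {}"
    proof -
      have "e \<in> ?gD" if "e + k = g + s" "k \<in> K" "s \<in> S" for e k s
      proof -
        have "e = g + (s - k)" using that(1) by (metis add_diff_cancel add_diff_eq)
        then show ?thesis using SKD that by blast
      qed
      then show ?thesis by (force elim!: set_plus_elim)
    qed
    moreover have "(F - ?gD) \<inter> ((+) g ` S) = {}" using SD by auto
    ultimately obtain z where z: "z \<in> X" "\<And>h. h \<in> F - ?gD \<Longrightarrow> z h = x h"
        "\<And>h. h \<in> (+) g ` S \<Longrightarrow> z h = shift g p h"
      by (rule gluing_across_obtain[OF K x(1)]) (rule that)
    define v where "v = restrict z F"
    have v_eq: "v h = w h" if "h \<notin> ?gD" for h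
      using that z(2) x(2) by (auto simp: v_def)
    have "v \<in> ?Z"
    proof -
      have "\<exists>s\<in>S. v (h + s) \<noteq> p s" if h: "h \<in> M" for h
      proof -
        obtain s where s: "s \<in> S" "w (h + s) \<noteq> p s" using w h by (auto simp: avoiding_at_def)
        have "h + s \<notin> ?gD" using disj[OF h] SD s(1) by (auto simp: disjnt_iff)
        then have "v (h + s) \<noteq> p s" using v_eq s(2) by simp
        then show ?thesis using s(1) by blast
      qed
      then show ?thesis using z(1) by (auto simp: avoiding_at_def v_def language_def)
    qed
    moreover have "v (g + s) = p s" if "s \<in> S" for s
    proof -
      have "g + s \<in> F" using that SD gF by auto
      then show ?thesis using z(3) that by (simp add: v_def shift_def flip: add.assoc)
    qed
    then have "v \<notin> ?Z'" by (auto simp: avoiding_at_def)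
    moreover have "w = override_on v (restrict w ?gD) ?gD"
      using v_eq by (auto simp: override_on_def fun_eq_iff)
    ultimately show "w \<in> (\<lambda>(z, u). override_on z u ?gD) ` ((?Z - ?Z') \<times> (?gD \<rightarrow>\<^sub>E UNIV))"
      by (intro image_eqI[of _ _ "(v, restrict w ?gD)"]) auto
  qed
  then have "card ?Z \<le> card ((?Z - ?Z') \<times> (?gD \<rightarrow>\<^sub>E (UNIV :: 'a set)))"
    using fin D by (intro surj_card_le) (auto simp: finite_PiE)
  also have "\<dots> = (card ?Z - card ?Z') * CARD('a) ^ card D"
    using D card_Diff_subset[OF finite_subset[OF sub fin] sub]
    by (simp only: card_cartesian_product) (simp add: card_PiE card_image)
  finally have "real (card ?Z) \<le> (real (card ?Z) - real (card ?Z')) * C"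
    unfolding C_def using card_mono[OF fin sub] by (simp flip: of_nat_diff of_nat_mult of_nat_power)
  then show ?thesis using C0 by (simp add: field_simps)
qed

lemma card_avoiding_at_le:
  fixes X :: "('g::group_add \<Rightarrow> 'a::finite) set"
  assumes K: "gluing_across K X"
    and X: "shift_invariant X" and p: "p \<in> X" and F: "finite F" and D: "finite D"
    and SD: "S \<subseteq> D" and SKD: "\<And>s k. s \<in> S \<Longrightarrow> k \<in> K \<Longrightarrow> s - k \<in> D"
    and "finite M" "\<And>h. h \<in> M \<Longrightarrow> (+) h ` D \<subseteq> F"
    and "pairwise (\<lambda>g h. disjnt ((+) g ` D) ((+) h ` D)) M"
  shows "real (card (language F X \<inter> avoiding_at S p M))
    \<le> (1 - 1 / real (CARD('a) ^ card D)) ^ card M * real (card (language F X))"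
  using assms(8-)
proof (induction M rule: finite_induct)
  case empty
  then show ?case by (simp add: avoiding_at_def)
next
  case (insert g M)
  let ?c = "1 - 1 / real (CARD('a) ^ card D)"
  have c: "?c \<ge> 0" by (simp add: Suc_le_eq)
  have "real (card (language F X \<inter> avoiding_at S p (insert g M)))
      \<le> ?c * real (card (language F X \<inter> avoiding_at S p M))"
    using insert.prems insert.hyps
    by (intro card_avoiding_one_more_site[OF K X p F D SD SKD]) (auto simp: pairwise_insert)
  also have "\<dots> \<le> ?c * (?c ^ card M * real (card (language F X)))"
    using insert.prems by (intro mult_left_mono insert.IH c) (auto simp: pairwise_insert)
  finally show ?case using insert.hyps by (simp add: mult.assoc)
qed

lemma language_subset_avoiding_at:
  assumes "shift_invariant Y" "restrict p S \<notin> language S Y" "\<And>g. g \<in> M \<Longrightarrow> (+) g ` S \<subseteq> F"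
  shows "language F Y \<subseteq> avoiding_at S p M"
proof
  fix w assume "w \<in> language F Y"
  then obtain y where y: "y \<in> Y" "w = restrict y F" by (auto simp: language_def)
  have "\<exists>s\<in>S. w (g + s) \<noteq> p s" if g: "g \<in> M" for g
  proof (rule ccontr)
    assume "\<not> (\<exists>s\<in>S. w (g + s) \<noteq> p s)"
    then have "y (g + s) = p s" if "s \<in> S" for s
      using that assms(3)[OF g] y(2) by (metis image_subset_iff restrict_apply')
    then have "restrict p S = restrict (shift (- g) y) S"
      by (intro restrict_ext) (simp add: shift_uminus_apply)
    moreover have "shift (- g) y \<in> Y" using assms(1) y(1) by (auto simp: shift_invariant_def)
    ultimately show False using assms(2) by (auto simp: language_def)
  qed
  then show "w \<in> avoiding_at S p M" by (auto simp: avoiding_at_def)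
qed

text \<open>
  Some pattern \<open>p(S)\<close> of \<open>X\<close> does not occur in \<open>Y\<close>. In \<open>F n\<close> there is room for a positive proportion
  of disjoint translates of \<open>D\<close>, and each of them makes the patterns of \<open>Y\<close> rarer among those of
  \<open>X\<close> by the factor \<open>1 - 1 / C \<le> exp (- 1 / C)\<close>. The rates of \<open>Y\<close> and \<open>X\<close> thus differ by at
  least a constant \<open>\<delta> > 0\<close> in the limit.
\<close>

theorem strongly_irreducible_imp_entropy_less:
  fixes X Y :: "('g::{group_add, countable} \<Rightarrow> 'a::finite) set"
  assumes am: "amenable TYPE('g)" and X: "subshift X" "strongly_irreducible X"
    and Y: "subshift Y" "Y \<noteq> {}" "Y \<subset> X"
  shows "entropy Y < entropy X"
proof -
  obtain F :: "nat \<Rightarrow> 'g set" where F: "folner_sequence F" using am by (auto simp: amenable_def)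
  have Fn: "finite (F n)" "F n \<noteq> {}" for n using F by (auto simp: folner_sequence_def)
  have inv: "shift_invariant X" "shift_invariant Y"
    using X Y by (auto intro: subshift_imp_shift_invariant)
  have Xne: "X \<noteq> {}" using Y by auto
  obtain K where K: "finite K" "gluing_across K X"
    using X(2) unfolding strongly_irreducible_def gluing_across_def by blast
  obtain p where p: "p \<in> X" "p \<notin> Y" using Y by blast
  have "closedin (product_topology (\<lambda>_. discrete_topology UNIV) UNIV) Y"
    using Y(1) by (simp add: subshift_def)
  then obtain S where S: "finite S" "restrict p S \<notin> language S Y"
    using closed_set_omits_finite_pattern[OF _ p(2)] by metis
  \<comment> \<open>The element \<open>0\<close> only serves to make \<open>D\<close> nonempty.\<close>
  define D where "D = insert 0 (S \<union> (\<lambda>(s, k). s - k) ` (S \<times> K))"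
  have D: "finite D" "D \<noteq> {}" "S \<subseteq> D" and SKD: "\<And>s k. s \<in> S \<Longrightarrow> k \<in> K \<Longrightarrow> s - k \<in> D"
    using S K unfolding D_def by auto
  have cD: "card D > 0" using D by (simp add: card_gt_0_iff)
  define C where "C = real (CARD('a) ^ card D)"
  have C: "C \<ge> 1" unfolding C_def by (simp add: Suc_le_eq)
  define \<delta> where "\<delta> = 1 / (C * (real (card D))\<^sup>2)"
  have \<delta>: "\<delta> > 0" using C cD by (simp add: \<delta>_def)
  define \<beta> where "\<beta> n = real (card (right_boundary D (F n))) / real (card (F n))" for n
  have gap: "language_rate Y (F n) \<le> language_rate X (F n) - \<delta> * (1 - \<beta> n)" for n
  proof -
    have cF: "real (card (F n)) > 0" using Fn by (simp add: card_gt_0_iff)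
    \<comment> \<open>\<open>A\<close> consists of sites \<open>g\<close> with \<open>gD\<close> inside \<open>F n\<close>.\<close>
    define A where "A = F n - right_boundary D (F n)"
    obtain M where M: "M \<subseteq> A" "pairwise (\<lambda>g h. disjnt ((+) g ` D) ((+) h ` D)) M"
        "card A \<le> card M * (card D)\<^sup>2"
      using exists_many_disjoint_translates[of A D] Fn D unfolding A_def by blast
    have MF: "(+) g ` D \<subseteq> F n" if "g \<in> M" for g
      using that M(1) by (auto simp: A_def right_boundary_def)
    have finM: "finite M" using M(1) Fn by (auto simp: A_def intro: finite_subset)
    have cM: "\<delta> * (1 - \<beta> n) * card (F n) \<le> card M / C"
    proof -
      have "real (card A) \<le> card M * (card D)\<^sup>2" using M(3) by (simp flip: of_nat_mult of_nat_power)
      moreover have "real (card A) = real (card (F n)) - real (card (right_boundary D (F n)))"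
        using Fn unfolding A_def
        by (subst card_Diff_subset) (auto simp: right_boundary_def intro!: of_nat_diff card_mono)
      moreover have "\<dots> = (1 - \<beta> n) * card (F n)" using cF by (simp add: \<beta>_def field_simps)
      ultimately have "\<delta> * ((1 - \<beta> n) * card (F n)) \<le> \<delta> * (card M * (card D)\<^sup>2)"
        using \<delta> by (intro mult_left_mono) auto
      also have "\<dots> = card M / C" using cD C by (simp add: \<delta>_def)
      finally show ?thesis by (simp add: mult.assoc)
    qed
    have "language (F n) Y \<subseteq> language (F n) X \<inter> avoiding_at S p M"
      using language_mono[of Y X] Y(3) MF D(3)
      by (intro Int_greatest language_subset_avoiding_at inv S) blast+
    then have "card (language (F n) Y) \<le> card (language (F n) X \<inter> avoiding_at S p M)"
      using Fn by (intro card_mono) (auto simp: finite_language)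
    also have "real \<dots> \<le> (1 - 1 / C) ^ card M * card (language (F n) X)"
      unfolding C_def
      by (intro card_avoiding_at_le[OF K(2) inv(1) p(1) Fn(1) D(1,3) SKD finM MF M(2)])
    also have "\<dots> \<le> exp (- (1 / C)) ^ card M * card (language (F n) X)"
      using C exp_ge_add_one_self[of "- (1 / C)"] by (intro mult_right_mono power_mono) auto
    also have "\<dots> = exp (- (card M / C)) * card (language (F n) X)"
      by (simp flip: exp_of_nat_mult)
    finally have *: "real (card (language (F n) Y)) \<le> exp (- (card M / C)) * card (language (F n) X)"
      by simp
    have pos: "real (card (language (F n) Y)) > 0" "real (card (language (F n) X)) > 0"
      using card_language_pos[OF Fn(1) Y(2)] card_language_pos[OF Fn(1) Xne] by simp_all
    have "ln (card (language (F n) Y)) \<le> ln (exp (- (card M / C)) * card (language (F n) X))"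
      using * pos by (subst ln_le_cancel_iff) auto
    also have "\<dots> = ln (card (language (F n) X)) - card M / C"
      using pos by (simp add: ln_mult)
    also have "\<dots> \<le> ln (card (language (F n) X)) - \<delta> * (1 - \<beta> n) * card (F n)"
      using cM by simp
    finally have "ln (card (language (F n) Y)) / card (F n)
        \<le> (ln (card (language (F n) X)) - \<delta> * (1 - \<beta> n) * card (F n)) / card (F n)"
      by (intro divide_right_mono) auto
    then show ?thesis using cF by (simp add: language_rate_def diff_divide_distrib)
  qed
  have "\<beta> \<longlonglongrightarrow> 0"
    unfolding \<beta>_def by (intro folner_right_boundary_tendsto_0 F D)
  then have "(\<lambda>n. language_rate X (F n) - \<delta> * (1 - \<beta> n)) \<longlonglongrightarrow> entropy X - \<delta> * (1 - 0)"
    by (intro tendsto_intros language_rate_tendsto_entropy inv Xne F)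
  then have "entropy Y \<le> entropy X - \<delta> * (1 - 0)"
    by (intro LIMSEQ_le[OF language_rate_tendsto_entropy[OF inv(2) Y(2) F]]) (use gap in auto)
  then show ?thesis using \<delta> by simp
qed

section \<open>The finite extension property\<close>

text \<open>
  If \<open>E\<close> stays away from \<open>F\<close> by the differences \<open>k - k'\<close>, then \<open>EK\<close> and \<open>FK\<close> are disjoint. Points
  \<open>x\<close> and \<open>y\<close> of \<open>X\<close> can then be put side by side on \<open>EK\<close> and \<open>FK\<close>. Every window \<open>gK\<close> with
  \<open>g \<in> E \<union> F\<close> lies in one of the two parts, where no forbidden pattern occurs, so the finite
  extension property yields a point of \<open>X\<close> that extends both patterns.
\<close>

lemma finite_extension_property_imp_strongly_irreducible:
  fixes X :: "('g::group_add \<Rightarrow> 'a::finite) set"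
  assumes "finite_extension_property X"
  shows "strongly_irreducible X"
proof -
  obtain K \<F> where K: "finite K" "0 \<in> K" "X = avoiding K \<F>" and
    ext: "\<And>S w w'. w \<in> S \<rightarrow>\<^sub>E UNIV \<Longrightarrow> w' \<in> (S + K) \<rightarrow>\<^sub>E UNIV \<Longrightarrow> restrict w' S = w \<Longrightarrow>
       (\<And>g. g \<in> S \<Longrightarrow> translate_pattern (- g) ((+) g ` K) (restrict w' ((+) g ` K)) \<notin> \<F>) \<Longrightarrow>
       \<exists>x \<in> X. restrict x S = w"
    using assms unfolding finite_extension_property_def by metis
  define L where "L = (\<lambda>(k, k'). k - k') ` (K \<times> K)"
  have window: "translate_pattern (- g) ((+) g ` K) (restrict w ((+) g ` K)) = restrict (shift (- g) w) K"
    for g and w :: "'g \<Rightarrow> 'a"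
    unfolding translate_pattern_def
    by (auto simp: fun_eq_iff restrict_def shift_uminus_apply image_image add.assoc[symmetric])
  have glue: "override_on v u E \<in> language (E \<union> F) X"
    if u: "u \<in> language E X" and v: "v \<in> language F X" and disj: "(E + L) \<inter> F = {}" for E F u v
  proof -
    obtain x y where x: "x \<in> X" "u = restrict x E" and y: "y \<in> X" "v = restrict y F"
      using u v by (auto simp: language_def)
    have disjK: "e + k \<noteq> f + k'" if "e \<in> E" "f \<in> F" "k \<in> K" "k' \<in> K" for e f k k'
    proof
      assume "e + k = f + k'"
      then have "f = e + (k - k')" by (metis add_diff_cancel add_diff_eq)
      then have "f \<in> E + L" using that by (auto simp: L_def intro!: set_plus_intro)
      then show False using disj that by blast
    qed
    define w' where "w' = restrict (override_on y x (E + K)) ((E \<union> F) + K)"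
    have w'E: "w' (g + k) = x (g + k)" if "g \<in> E" "k \<in> K" for g k
      using that by (auto simp: w'_def override_on_def intro: set_plus_intro)
    have w'F: "w' (g + k) = y (g + k)" if "g \<in> F" "k \<in> K" for g k
    proof -
      have "g + k \<notin> E + K" using disjK that by (auto simp: set_plus_def) metis
      then show ?thesis using that by (auto simp: w'_def override_on_def intro: set_plus_intro)
    qed
    have w'_eq: "restrict w' (E \<union> F) = override_on v u E"
    proof
      fix h
      show "restrict w' (E \<union> F) h = override_on v u E h"
        using w'E[of h 0] w'F[of h 0] K(2) x(2) y(2) by (auto simp: override_on_def)
    qed
    have "translate_pattern (- g) ((+) g ` K) (restrict w' ((+) g ` K)) \<notin> \<F>"
      if g: "g \<in> E \<union> F" for g
    proof -
      have "\<exists>z\<in>X. restrict (shift (- g) w') K = restrict (shift (- g) z) K"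
      proof (cases "g \<in> E")
        case True
        then show ?thesis using w'E x(1)
          by (intro bexI[of _ x] restrict_ext) (auto simp: shift_uminus_apply)
      next
        case False
        then show ?thesis using w'F y(1) g
          by (intro bexI[of _ y] restrict_ext) (auto simp: shift_uminus_apply)
      qed
      then show ?thesis unfolding window K(3) avoiding_def by auto
    qed
    then have "\<exists>z\<in>X. restrict z (E \<union> F) = restrict w' (E \<union> F)"
    proof (intro ext[where w' = w'] refl)
      show "restrict w' (E \<union> F) \<in> (E \<union> F) \<rightarrow>\<^sub>E UNIV" by (simp only: restrict_PiE_iff) simp
      show "w' \<in> ((E \<union> F) + K) \<rightarrow>\<^sub>E UNIV" unfolding w'_def by (simp only: restrict_PiE_iff) simp
    qed
    then obtain z where "z \<in> X" "override_on v u E = restrict z (E \<union> F)"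
      unfolding w'_eq by metis
    then show ?thesis by (simp add: language_def)
  qed
  have "finite L" using K(1) by (simp add: L_def)
  then show ?thesis unfolding strongly_irreducible_def
    by (intro exI[of _ L] conjI allI ballI impI glue)
qed

theorem proposition3p4:
  fixes X :: "('g::{group_add, countable} \<Rightarrow> 'a::finite) set"
  assumes "amenable TYPE('g)"
    and "subshift X"
  shows "(strongly_irreducible X \<and> finite_type X \<longrightarrow> entropy_minimal X) \<and>
         (finite_extension_property X \<longrightarrow> entropy_minimal X)"
proof -
  have "entropy_minimal X" if "strongly_irreducible X"
    unfolding entropy_minimal_def
    using strongly_irreducible_imp_entropy_less[OF assms that] by simp
  then show ?thesis using finite_extension_property_imp_strongly_irreducible by blast
qed

end
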